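(* Let $A,B,X\in\mathcal{M}_n$ be such that $\begin{bmatrix} A & X^*\\ X & B\end{bmatrix}$ is PPT, and let $X=U|X|$ be a polar decomposition of $X$ with $U\in\mathcal{M}_n$ unitary. Then for every $0\le t\le 1$, $$|X|\le \left(A\sharp_t B\right)\sharp\left(U^*(A\sharp_{1-t}B)U\right)$$ and $$|X^*|\le \left(U(A\sharp_t B)U^*\right)\sharp\left(A\sharp_{1-t}B\right).$$
   Context: $\mathcal{M}_n$ is the algebra of $n\times n$ complex matrices. $A\ge O$ means $A$ is positive semidefinite, $A>O$ means positive definite, and $A\le B$ means $B-A\ge O$. $|X|=(X^*X)^{1/2}$. A block matrix $\begin{bmatrix} A & X^*\\ X & B\end{bmatrix}$ is PPT (positive partial transpose) if both $\begin{bmatrix} A & X^*\\ X & B\end{bmatrix}$ and $\begin{bmatrix} A & X\\ X^* & B\end{bmatrix}$ are positive semidefinite. For $A,B>O$ and $0\le t\le 1$, $A\sharp_t B=A^{1/2}(A^{-1/2}BA^{-1/2})^tA^{1/2}$, and $A\sharp B=A\sharp_{1/2}B$. For positive semidefinite $A,B$, $A\sharp_t B$ is understood as $\lim_{\varepsilon\to0^+}(A+\varepsilon I)\sharp_t(B+\varepsilon I)$. Polar decomposition $X=U|X|$ is taken with $U$ unitary. *)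

theory Defs
  imports "HOL-Analysis.Analysis"
begin

definition conj_transpose :: "complex^'n^'m \<Rightarrow> complex^'m^'n"
  where "conj_transpose A = (\<chi> i j. cnj (A $ j $ i))"

definition hermitian :: "complex^'n^'n \<Rightarrow> bool"
  where "hermitian A \<longleftrightarrow> conj_transpose A = A"

definition unitary :: "complex^'n^'n \<Rightarrow> bool"
  where "unitary U \<longleftrightarrow>
    conj_transpose U ** U = mat 1 \<and> U ** conj_transpose U = mat 1"

definition quad_form :: "complex^'n^'n \<Rightarrow> complex^'n \<Rightarrow> complex"
  where "quad_form A x = (\<Sum>i\<in>UNIV. cnj (x $ i) * (A *v x) $ i)"

text \<open>For Hermitian matrices the quadratic form is real-valued, so that \<^term>\<open>Re\<close> below
  loses nothing.\<close>

definition pos_semidef :: "complex^'n^'n \<Rightarrow> bool"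
  where "pos_semidef A \<longleftrightarrow> hermitian A \<and> (\<forall>x. 0 \<le> Re (quad_form A x))"

definition pos_def :: "complex^'n^'n \<Rightarrow> bool"
  where "pos_def A \<longleftrightarrow> hermitian A \<and> (\<forall>x. x \<noteq> 0 \<longrightarrow> 0 < Re (quad_form A x))"

text \<open>The library order on vectors is componentwise, hence a separate symbol for the
  Loewner order.\<close>

definition loewner_le :: "complex^'n^'n \<Rightarrow> complex^'n^'n \<Rightarrow> bool"  (infix "\<preceq>\<^sub>L" 50)
  where "A \<preceq>\<^sub>L B \<longleftrightarrow> pos_semidef (B - A)"

definition block_matrix ::
    "complex^'n^'n \<Rightarrow> complex^'n^'n \<Rightarrow> complex^'n^'n \<Rightarrow> complex^'n^'n
      \<Rightarrow> complex^('n + 'n)^('n + 'n)"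
  where "block_matrix A B C D = (\<chi> i j.
    (case (i, j) of
       (Inl a, Inl b) \<Rightarrow> A $ a $ b
     | (Inl a, Inr b) \<Rightarrow> B $ a $ b
     | (Inr a, Inl b) \<Rightarrow> C $ a $ b
     | (Inr a, Inr b) \<Rightarrow> D $ a $ b))"

definition ppt_block :: "complex^'n^'n \<Rightarrow> complex^'n^'n \<Rightarrow> complex^'n^'n \<Rightarrow> bool"
  where "ppt_block A X B \<longleftrightarrow>
    pos_semidef (block_matrix A (conj_transpose X) X B) \<and>
    pos_semidef (block_matrix A X (conj_transpose X) B)"

definition diag_real :: "('n \<Rightarrow> real) \<Rightarrow> complex^'n^'n"
  where "diag_real d = (\<chi> i j. if i = j then complex_of_real (d i) else 0)"

text \<open>Functional calculus for Hermitian matrices via unitary diagonalisation.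
  The result does not depend on the chosen diagonalisation, see
  \<open>matrix_fun_diagonalisation\<close>; for a matrix that is not unitarily diagonalisable
  with real eigenvalues the value is unspecified.\<close>

definition matrix_fun :: "(real \<Rightarrow> real) \<Rightarrow> complex^'n^'n \<Rightarrow> complex^'n^'n"
  where "matrix_fun f A = (THE M. \<exists>U d. unitary U \<and>
     A = U ** diag_real d ** conj_transpose U \<and>
     M = U ** diag_real (\<lambda>i. f (d i)) ** conj_transpose U)"

text \<open>Real powers: of positive definite matrices for any exponent, and of positive
  semidefinite matrices for positive exponents (as \<open>0 powr t = 0\<close>).\<close>

definition matrix_powr :: "complex^'n^'n \<Rightarrow> real \<Rightarrow> complex^'n^'n"
  where "matrix_powr A t = matrix_fun (\<lambda>x. x powr t) A"

definition matrix_abs :: "complex^'n^'n \<Rightarrow> complex^'n^'n"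
  where "matrix_abs X = matrix_powr (conj_transpose X ** X) (1/2)"

definition geom_mean_pd :: "real \<Rightarrow> complex^'n^'n \<Rightarrow> complex^'n^'n \<Rightarrow> complex^'n^'n"
  where "geom_mean_pd t A B =
    matrix_powr A (1/2) **
      matrix_powr (matrix_powr A (-1/2) ** B ** matrix_powr A (-1/2)) t **
    matrix_powr A (1/2)"

text \<open>Outside the positive definite case: the limit under the perturbation
  \<open>A + \<epsilon> I\<close>, \<open>B + \<epsilon> I\<close> as \<open>\<epsilon>\<close> decreases to \<open>0\<close>.\<close>

definition geom_mean :: "real \<Rightarrow> complex^'n^'n \<Rightarrow> complex^'n^'n \<Rightarrow> complex^'n^'n"
  where "geom_mean t A B =
    (if pos_def A \<and> pos_def B then geom_mean_pd t A B
     else Lim (at_right (0::real))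
       (\<lambda>\<epsilon>. geom_mean_pd t (A + \<epsilon> *\<^sub>R mat 1) (B + \<epsilon> *\<^sub>R mat 1)))"

lemma conj_transpose_mult: "conj_transpose (A ** B) = conj_transpose B ** conj_transpose A"
  by (simp add: conj_transpose_def matrix_matrix_mult_def vec_eq_iff mult.commute)

lemma diag_real_mult_right: "(A ** diag_real d) $ i $ j = A $ i $ j * complex_of_real (d j)"
  by (simp add: matrix_matrix_mult_def diag_real_def if_distrib cong: if_cong)

lemma diag_real_mult_left: "(diag_real d ** A) $ i $ j = complex_of_real (d i) * A $ i $ j"
  by (simp add: matrix_matrix_mult_def diag_real_def if_distrib if_distribR cong: if_cong)

lemma matrix_fun_diagonalisation:
  assumes U: "unitary U"
  shows "matrix_fun f (U ** diag_real d ** conj_transpose U)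
    = U ** diag_real (\<lambda>i. f (d i)) ** conj_transpose U"
  unfolding matrix_fun_def
proof (rule the_equality)
  show "\<exists>V e. unitary V \<and>
      U ** diag_real d ** conj_transpose U = V ** diag_real e ** conj_transpose V \<and>
      U ** diag_real (\<lambda>i. f (d i)) ** conj_transpose U =
        V ** diag_real (\<lambda>i. f (e i)) ** conj_transpose V"
    using U by blast
next
  fix M
  assume "\<exists>V e. unitary V \<and>
      U ** diag_real d ** conj_transpose U = V ** diag_real e ** conj_transpose V \<and>
      M = V ** diag_real (\<lambda>i. f (e i)) ** conj_transpose V"
  then obtain V e where V: "unitary V"
    and eq: "U ** diag_real d ** conj_transpose U = V ** diag_real e ** conj_transpose V"
    and M: "M = V ** diag_real (\<lambda>i. f (e i)) ** conj_transpose V" by blast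
  define W where "W = conj_transpose V ** U"
  have VW: "V ** W = U" and WU: "W ** conj_transpose U = conj_transpose V"
    using U V unfolding W_def unitary_def
    by (metis matrix_mul_assoc matrix_mul_lid, metis matrix_mul_assoc matrix_mul_rid)
  have "W ** diag_real d = conj_transpose V ** (U ** diag_real d ** conj_transpose U) ** U"
    using U unfolding W_def unitary_def by (metis matrix_mul_assoc matrix_mul_rid)
  also have "\<dots> = diag_real e ** W"
    unfolding eq using V unfolding W_def unitary_def by (metis matrix_mul_assoc matrix_mul_lid)
  finally have comm: "W ** diag_real d = diag_real e ** W" .
  have "W $ i $ j * complex_of_real (f (d j)) = complex_of_real (f (e i)) * W $ i $ j" for i j
  proof -
    have "W $ i $ j * complex_of_real (d j) = complex_of_real (e i) * W $ i $ j"
      using comm by (metis diag_real_mult_left diag_real_mult_right)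
    then have "W $ i $ j = 0 \<or> d j = e i" by auto
    then show ?thesis by auto
  qed
  then have comm': "W ** diag_real (\<lambda>i. f (d i)) = diag_real (\<lambda>i. f (e i)) ** W"
    by (simp add: vec_eq_iff diag_real_mult_left diag_real_mult_right)
  have "M = V ** diag_real (\<lambda>i. f (e i)) ** (W ** conj_transpose U)"
    using M WU by simp
  also have "\<dots> = V ** (diag_real (\<lambda>i. f (e i)) ** W) ** conj_transpose U"
    by (simp add: matrix_mul_assoc)
  also have "\<dots> = U ** diag_real (\<lambda>i. f (d i)) ** conj_transpose U"
    by (simp flip: comm' add: VW matrix_mul_assoc)
  finally show "M = U ** diag_real (\<lambda>i. f (d i)) ** conj_transpose U" .
qed

end

theory Submission
  imports Defs
begin

text \<open>For positive definite \<open>A\<close>, \<open>B\<close> the PPT condition says \<open>X\<^sup>* B\<^sup>-\<^sup>1 X \<le> A\<close> and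
  \<open>X\<^sup>* A\<^sup>-\<^sup>1 X \<le> B\<close>. Both \<open>t \<mapsto> A \<sharp>\<^sub>t B\<close> and \<open>t \<mapsto> X\<^sup>* (A \<sharp>\<^sub>1\<^sub>-\<^sub>t B)\<^sup>-\<^sup>1 X\<close> are curves of the form
  \<open>S E\<^sup>t S\<^sup>*\<close>; such curves are compared on all of \<open>[0, 1]\<close> once they are compared at the end points,
  because the set of good \<open>t\<close> is closed and, by maximality of the geometric mean, closed under
  midpoints. Hence \<open>[A \<sharp>\<^sub>t B, X\<^sup>*; X, A \<sharp>\<^sub>1\<^sub>-\<^sub>t B]\<close> is positive semidefinite. A congruence with \<open>U\<close> makes
  its off-diagonal blocks \<open>|X|\<close> or \<open>|X\<^sup>*|\<close>, and maximality of the geometric mean applies again.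
  The semidefinite case follows by perturbation; the defining limits exist because the same
  comparison shows that the geometric mean is monotone in its arguments.\<close>

section \<open>Diagonalisation of Hermitian matrices\<close>

text \<open>\<open>inner\<close> on \<open>complex^'n\<close> is the real part of the Hermitian
  product, so adjoints move across it as usual. All later estimates are carried out with this real
  form.\<close>

lemma inner_adjoint:
  fixes A :: "complex^'n^'m"
  shows "inner x (A *v y) = inner (conj_transpose A *v x) y"
proof -
  have "inner x (A *v y) = Re (\<Sum>i\<in>UNIV. \<Sum>j\<in>UNIV. cnj (x $ i) * A $ i $ j * y $ j)"
    by (simp add: inner_vec_def inner_complex_def matrix_vector_mult_def sum_distrib_left mult.assoc
        flip: Re_sum)
       (simp add: algebra_simps sum_distrib_left sum.distrib sum_subtractf)
  also have "\<dots> = Re (\<Sum>j\<in>UNIV. \<Sum>i\<in>UNIV. cnj (x $ i) * A $ i $ j * y $ j)"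
    by (subst sum.swap) simp
  also have "\<dots> = inner (conj_transpose A *v x) y"
    by (simp add: inner_vec_def inner_complex_def matrix_vector_mult_def conj_transpose_def
        sum_distrib_right sum_distrib_left algebra_simps sum.distrib sum_subtractf)
  finally show ?thesis .
qed

lemma conj_transpose_conj_transpose [simp]: "conj_transpose (conj_transpose A) = A"
  by (simp add: conj_transpose_def vec_eq_iff)

lemma conj_transpose_mat_1 [simp]: "conj_transpose (mat 1) = mat 1"
  by (simp add: conj_transpose_def mat_def vec_eq_iff)

lemma conj_transpose_diag_real [simp]: "conj_transpose (diag_real d) = diag_real d"
  by (simp add: conj_transpose_def diag_real_def vec_eq_iff)

lemma diag_real_mult [simp]: "diag_real d ** diag_real e = diag_real (\<lambda>i. d i * e i)"
  unfolding vec_eq_iff diag_real_mult_left by (simp add: diag_real_def)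

lemma diag_real_one [simp]: "diag_real (\<lambda>i. 1) = mat 1"
  by (simp add: diag_real_def mat_def vec_eq_iff)

lemma diag_real_mult_vec: "(diag_real d *v x) $ i = d i *\<^sub>R x $ i"
  by (simp add: diag_real_def matrix_vector_mult_def if_distribR if_distrib scaleR_conv_of_real
      cong: if_cong)

lemma Re_quad_form: "Re (quad_form A x) = inner x (A *v x)"
  by (simp add: quad_form_def inner_vec_def inner_complex_def)

lemma pos_semidef_iff: "pos_semidef A \<longleftrightarrow> hermitian A \<and> (\<forall>x. 0 \<le> inner x (A *v x))"
  by (simp add: pos_semidef_def Re_quad_form)

lemma pos_def_iff: "pos_def A \<longleftrightarrow> hermitian A \<and> (\<forall>x. x \<noteq> 0 \<longrightarrow> 0 < inner x (A *v x))"
  by (simp add: pos_def_def Re_quad_form)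

lemma hermitian_inner: "hermitian A \<Longrightarrow> inner x (A *v y) = inner (A *v x) y"
  by (simp add: inner_adjoint hermitian_def)

lemma hermitian_congruence: "hermitian B \<Longrightarrow> hermitian (S ** B ** conj_transpose S)"
  by (simp add: hermitian_def conj_transpose_mult matrix_mul_assoc)

lemma hermitian_diff: "hermitian A \<Longrightarrow> hermitian B \<Longrightarrow> hermitian (A - B)"
  by (simp add: hermitian_def conj_transpose_def vec_eq_iff)

lemma loewner_leI:
  "\<lbrakk>hermitian A; hermitian B; \<And>x. inner x (A *v x) \<le> inner x (B *v x)\<rbrakk> \<Longrightarrow> A \<preceq>\<^sub>L B"
  by (simp add: loewner_le_def pos_semidef_iff hermitian_diff matrix_vector_mult_diff_rdistrib
      inner_diff_right)

section \<open>Eigenvectors from Rayleigh quotients and the spectral theorem\<close>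

lemma linear_matrix_vector_mult: "linear ((*v) (A :: complex^'n^'m))"
  by (rule linearI)
     (simp_all add: matrix_vector_mult_def vec_eq_iff scaleR_sum_right ring_distribs sum.distrib)

text \<open>A maximiser x of the Rayleigh quotient <y, f y> / <y, g y> over the unit sphere of W
  works: with the maximum as l, the form l <y, g y> - <y, f y> is nonnegative on W and vanishes at
  x, so its gradient vanishes there too. The choice g = id gives ordinary eigenvectors in an
  invariant subspace; a definite matrix as g gives the pencil behind the maximality of the geometric
  mean.\<close>

lemma generalized_eigenvector_exists:
  fixes f g :: "'a::euclidean_space \<Rightarrow> 'a"
  assumes f: "linear f" "\<And>x y. inner x (f y) = inner (f x) y"
    and g: "linear g" "\<And>x y. inner x (g y) = inner (g x) y"
    and g_pos: "\<And>x. x \<noteq> 0 \<Longrightarrow> 0 < inner x (g x)"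
    and W: "subspace W" "f ` W \<subseteq> W" "g ` W \<subseteq> W" and w: "w \<in> W" "w \<noteq> 0"
  shows "\<exists>x\<in>W. \<exists>l. norm x = 1 \<and> f x = l *\<^sub>R g x \<and>
    (\<forall>y\<in>W. inner y (f y) \<le> l * inner y (g y))"
proof -
  define h where "h x = inner x (f x) / inner x (g x)" for x
  define K where "K = W \<inter> sphere 0 1"
  have K: "compact K" unfolding K_def
    using W(1) by (simp add: closed_Int_compact closed_subspace)
  have "(1 / norm w) *\<^sub>R w \<in> K" using w W(1) by (simp add: K_def subspace_scale)
  then have Kne: "K \<noteq> {}" by blast
  have gK: "inner x (g x) \<noteq> 0" if "x \<in> K" for x
    using g_pos[of x] that by (force simp: K_def)
  have "continuous_on K h" unfolding h_def using gK
    by (intro continuous_intros linear_continuous_on linear_conv_bounded_linear[THEN iffD1] f g) auto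
  then obtain x where x: "x \<in> K" "\<And>y. y \<in> K \<Longrightarrow> h y \<le> h x"
    using continuous_attains_sup[OF K Kne] by blast
  define p where "p y = h x * inner y (g y) - inner y (f y)" for y
  have p: "0 \<le> p y" if y: "y \<in> W" for y
  proof (cases "y = 0")
    case True then show ?thesis by (simp add: p_def)
  next
    case False
    then have "(1 / norm y) *\<^sub>R y \<in> K" using y W(1) by (simp add: K_def subspace_scale)
    from x(2)[OF this] have "h y \<le> h x" using False
      by (simp add: h_def linear_cmul[OF f(1)] linear_cmul[OF g(1)])
    then show ?thesis using g_pos[OF False] by (simp add: h_def p_def field_simps)
  qed
  have px: "p x = 0" using gK[OF x(1)] by (simp add: p_def h_def)
  \<comment> \<open>\<open>z\<close> is half the gradient of \<open>p\<close> at \<open>x\<close>;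
    it stays in \<open>W\<close> by invariance.\<close>
  define z where "z = h x *\<^sub>R g x - f x"
  have xW: "x \<in> W" using x by (simp add: K_def)
  have zW: "z \<in> W" unfolding z_def using W xW by (intro subspace_diff subspace_scale) auto
  have "p (x - s *\<^sub>R u) = p x - 2 * s * inner u z + s\<^sup>2 * p u" for s u
    using f(2)[of x u] g(2)[of x u]
    by (simp add: p_def z_def linear_diff[OF f(1)] linear_diff[OF g(1)] linear_cmul[OF f(1)]
        linear_cmul[OF g(1)] inner_diff_left inner_diff_right inner_commute ring_distribs
        power2_eq_square)
  note expand = this[of _ z]
  have "z = 0"
  proof (rule ccontr)
    assume "z \<noteq> 0"
    then have zz: "0 < inner z z" by simp
    \<comment> \<open>Moving from \<open>x\<close> by -s z changes \<open>p\<close> by -2 s <z, z> +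
      s^2 \<open>p z\<close>. This \<open>s\<close> is so small that the quadratic term stays below
      half of the linear one; the 1 in the denominator covers \<open>p z = 0\<close>.\<close>
    define s where "s = inner z z / (p z + 1)"
    have s: "0 < s" "s * p z < inner z z"
      using zz p[OF zW] by (auto simp: s_def field_simps)
    have "0 \<le> p (x - s *\<^sub>R z)"
      using xW zW W(1) by (intro p subspace_diff subspace_scale)
    also have "\<dots> = s * (s * p z - inner z z) - s * inner z z"
      unfolding expand px by (simp add: algebra_simps power2_eq_square)
    also have "\<dots> < 0" using s zz by (smt (verit) mult_pos_pos mult_pos_neg)
    finally show False by simp
  qed
  with xW x(1) p show ?thesis
    by (intro bexI[of _ x] exI[of _ "h x"]) (auto simp: z_def p_def K_def)
qed

lemma matrix_vector_mult_vscale: "(A :: complex^'n^'m) *v (c *s x) = c *s (A *v x)"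
  by (simp add: matrix_vector_mult_def vec_eq_iff sum_distrib_left mult_ac)

text \<open>Multiplying by \<open>\<i>\<close> turns an imaginary part into a real part, so complex
  orthogonality can be expressed by two real inner products.\<close>

lemma Im_sum_cnj_eq_inner: "Im (\<Sum>k\<in>UNIV. cnj (x $ k) * y $ k) = inner (\<i> *s x) y"
  for x y :: "complex^'n"
  by (simp add: inner_vec_def inner_complex_def algebra_simps)

lemma Re_sum_cnj_eq_inner: "Re (\<Sum>k\<in>UNIV. cnj (x $ k) * y $ k) = inner x y"
  for x y :: "complex^'n"
  by (simp add: inner_vec_def inner_complex_def algebra_simps)

lemma inner_ii_left: "inner (\<i> *s x) y = - inner x (\<i> *s y)" for x y :: "complex^'n"
  by (simp add: inner_vec_def inner_complex_def algebra_simps flip: sum_negf)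

text \<open>Induction over the index set: the complex orthogonal complement of the vectors found so
  far is invariant under A and nonzero by a dimension count, so the Rayleigh quotient supplies one
  more eigenvector in it.\<close>

lemma orthonormal_eigenvectors_exist:
  fixes A :: "complex^'n^'n" and I :: "'n set"
  assumes A: "hermitian A"
  shows "\<exists>v d. (\<forall>i\<in>I. A *v v i = d i *\<^sub>R v i) \<and>
    (\<forall>i\<in>I. \<forall>j\<in>I. inner (v i) (v j) = (if i = j then 1 else 0) \<and> inner (\<i> *s v i) (v j) = 0)"
  using finite[of I]
proof (induction I rule: finite_induct)
  case empty
  show ?case by simp
next
  case (insert i I)
  then obtain v :: "'n \<Rightarrow> complex^'n" and d where ev: "\<And>i. i \<in> I \<Longrightarrow> A *v v i = d i *\<^sub>R v i"
    and on: "\<And>i j. i \<in> I \<Longrightarrow> j \<in> I \<Longrightarrow> inner (v i) (v j) = (if i = j then 1 else 0)"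
      "\<And>i j. i \<in> I \<Longrightarrow> j \<in> I \<Longrightarrow> inner (\<i> *s v i) (v j) = 0" by blast
  define W where "W = {x. \<forall>i\<in>I. inner (v i) x = 0 \<and> inner (\<i> *s v i) x = 0}"
  have W: "subspace W" by (auto simp: W_def subspace_def inner_add_right)
  have inv: "A *v x \<in> W" if "x \<in> W" for x
    using that
    by (auto simp: W_def hermitian_inner[OF A] ev matrix_vector_mult_vscale)
       (metis (no_types, lifting) ev inner_commute inner_ii_left inner_scaleR_right neg_equal_0_iff_equal mult_zero_right inner_scaleR_left)
  \<comment> \<open>Each complex vector accounts for two real ones: \<open>S\<close> has at most
    \<open>2 * card I\<close> elements, fewer than the real dimension
    \<open>2 * CARD('n)\<close>.\<close>
  define S where "S = v ` I \<union> (\<lambda>i. \<i> *s v i) ` I"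
  have "card I < CARD('n)"
    using insert.hyps by (metis card_mono card_insert_disjoint finite subset_UNIV Suc_le_eq)
  moreover have "card S \<le> card I + card I" unfolding S_def
    by (rule order_trans[OF card_Un_le]) (intro add_mono card_image_le insert.hyps)
  moreover have "dim S \<le> card S" using insert.hyps by (intro dim_le_card) (auto simp: S_def span_base)
  ultimately have "dim S < DIM(complex^'n)" by simp
  then obtain w where w: "w \<noteq> 0" "\<And>y. y \<in> span S \<Longrightarrow> orthogonal w y"
    by (metis orthogonal_to_subspace_exists)
  then have wS: "inner w y = 0" if "y \<in> S" for y using that by (simp add: orthogonal_def span_base)
  then have "w \<in> W" by (auto simp: W_def S_def inner_commute[of _ w] wS)
  moreover have "linear (\<lambda>x :: complex^'n. x)" by (rule linear_ident)
  ultimately obtain x l where x: "x \<in> W" "norm x = 1" "A *v x = l *\<^sub>R x"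
    using generalized_eigenvector_exists[of "(*v) A" "\<lambda>x. x" W w] w(1) W inv hermitian_inner[OF A]
      linear_matrix_vector_mult[of A] by (metis image_subsetI inner_gt_zero_iff)
  \<comment> \<open>Multiplication by \<open>\<i>\<close> is skew for the real inner product, so
    \<open>x\<close> is always orthogonal to \<open>\<i> *s x\<close>.\<close>
  have xx: "inner (\<i> *s x) x = 0" "inner x x = 1"
    using inner_ii_left[of x x] x(2) by (simp_all add: inner_commute dot_square_norm)
  have vx: "inner (v j) x = 0" "inner x (v j) = 0" "inner (\<i> *s v j) x = 0"
      "inner (\<i> *s x) (v j) = 0" if "j \<in> I" for j
    using x(1) that inner_ii_left[of x "v j"] by (auto simp: W_def inner_commute)
  define v' where "v' = v(i := x)"
  define d' where "d' = d(i := l)"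
  have v': "v' i = x" "d' i = l" "\<And>j. j \<in> I \<Longrightarrow> v' j = v j \<and> d' j = d j"
    using insert.hyps by (auto simp: v'_def d'_def)
  have ne: "\<And>j. j \<in> I \<Longrightarrow> j \<noteq> i" using insert.hyps by blast
  show ?case
  proof (intro exI[of _ v'] exI[of _ d'] conjI ballI)
    show "A *v v' j = d' j *\<^sub>R v' j" if "j \<in> insert i I" for j
      using that by (elim insertE) (simp_all add: v' x(3) ev)
    show "inner (v' j) (v' k) = (if j = k then 1 else 0)" "inner (\<i> *s v' j) (v' k) = 0"
      if "j \<in> insert i I" "k \<in> insert i I" for j k
      using that by (elim insertE; simp add: v' xx vx on ne ne[symmetric])+
  qed
qed

theorem hermitian_diagonalisation:
  fixes A :: "complex^'n^'n"
  assumes "hermitian A"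
  obtains U d where "unitary U" "A = U ** diag_real d ** conj_transpose U"
proof -
  obtain v :: "'n \<Rightarrow> complex^'n" and d where ev: "\<And>i. A *v v i = d i *\<^sub>R v i"
    and on: "\<And>i j. inner (v i) (v j) = (if i = j then 1 else 0)" "\<And>i j. inner (\<i> *s v i) (v j) = 0"
    using orthonormal_eigenvectors_exist[OF assms, of UNIV] by blast
  define U where "U = (\<chi> k i. v i $ k)"
  have "(\<Sum>k\<in>UNIV. cnj (v i $ k) * v j $ k) = (if i = j then 1 else 0)" for i j
    using on[of i j] unfolding Im_sum_cnj_eq_inner[symmetric] Re_sum_cnj_eq_inner[symmetric]
    by (auto simp: complex_eq_iff)
  then have UU: "conj_transpose U ** U = mat 1"
    by (simp add: conj_transpose_def matrix_matrix_mult_def mat_def vec_eq_iff U_def)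
  then have U: "unitary U" by (simp add: unitary_def matrix_left_right_inverse)
  have "(A ** U) $ k $ i = (U ** diag_real d) $ k $ i" for k i
    using ev[of i, unfolded vec_eq_iff, rule_format, of k]
    unfolding diag_real_mult_right
    unfolding vector_scaleR_component
    unfolding scaleR_conv_of_real
    by (simp add: matrix_matrix_mult_def matrix_vector_mult_def U_def mult.commute)
  then have "A ** U = U ** diag_real d" by (simp add: vec_eq_iff)
  then have "A = U ** diag_real d ** conj_transpose U"
    using U by (metis matrix_mul_assoc matrix_mul_rid unitary_def)
  with U show ?thesis by (rule that)
qed

section \<open>Curves of geometric means\<close>

text \<open>The curve of weighted geometric means: if \<open>A = S S\<^sup>*\<close> and \<open>B = S E S\<^sup>*\<close>, then
  \<open>A \<sharp>\<^sub>t B = S E\<^sup>t S\<^sup>*\<close>.\<close>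

definition geodesic :: "complex^'n^'n \<Rightarrow> ('n \<Rightarrow> real) \<Rightarrow> real \<Rightarrow> complex^'n^'n"
  where "geodesic S e t = S ** diag_real (\<lambda>i. e i powr t) ** conj_transpose S"

lemma hermitian_geodesic: "hermitian (geodesic S e t)"
  unfolding geodesic_def by (rule hermitian_congruence) (simp add: hermitian_def)

lemma inner_diagonalised:
  fixes S :: "complex^'n^'n"
  shows "inner x ((S ** diag_real d ** conj_transpose S) *v y) =
    (\<Sum>i\<in>UNIV. d i * inner ((conj_transpose S *v x) $ i) ((conj_transpose S *v y) $ i))"
proof -
  have "inner x ((S ** diag_real d ** conj_transpose S) *v y) =
    inner (conj_transpose S *v x) (diag_real d *v (conj_transpose S *v y))"
    by (simp add: matrix_vector_mul_assoc flip: inner_adjoint)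
       (simp add: matrix_mul_assoc)
  then show ?thesis unfolding inner_vec_def by (simp add: diag_real_mult_vec)
qed

lemma inner_geodesic:
  "inner x (geodesic S e t *v y) =
    (\<Sum>i\<in>UNIV. e i powr t * inner ((conj_transpose S *v x) $ i) ((conj_transpose S *v y) $ i))"
  unfolding geodesic_def by (rule inner_diagonalised)

lemma continuous_on_inner_geodesic:
  assumes "\<And>i. 0 < e i"
  shows "continuous_on T (\<lambda>t. inner x (geodesic S e t *v y))"
  unfolding inner_geodesic using assms by (auto intro!: continuous_intros simp: less_imp_neq[symmetric])

text \<open>In the coordinates given by \<open>conj_transpose S\<close>, each eigenvalue contributes
  the squared norm of e^(s/2) a + e^(t/2) b. So the block matrix with the curve at s and t on the
  diagonal and at their midpoint off it is positive semidefinite.\<close>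

lemma geodesic_block_nonneg:
  fixes S :: "complex^'n^'n"
  assumes e: "\<And>i. 0 < e i"
  shows "0 \<le> inner x (geodesic S e s *v x) + 2 * inner x (geodesic S e ((s + t) / 2) *v y)
    + inner y (geodesic S e t *v y)"
proof -
  define a where "a i = (conj_transpose S *v x) $ i" for i
  define b where "b i = (conj_transpose S *v y) $ i" for i
  have "0 \<le> (\<Sum>i\<in>UNIV. (norm (e i powr (s / 2) *\<^sub>R a i + e i powr (t / 2) *\<^sub>R b i))\<^sup>2)"
    by (intro sum_nonneg) simp
  also have "\<dots> = (\<Sum>i\<in>UNIV. e i powr s * inner (a i) (a i)
      + 2 * (e i powr ((s + t) / 2) * inner (a i) (b i)) + e i powr t * inner (b i) (b i))"
  proof (rule sum.cong[OF refl])
    fix i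
    have "e i powr s = e i powr (s / 2) * e i powr (s / 2)"
      "e i powr t = e i powr (t / 2) * e i powr (t / 2)"
      "e i powr ((s + t) / 2) = e i powr (s / 2) * e i powr (t / 2)"
      by (simp_all add: add_divide_distrib flip: powr_add)
    then show "(norm (e i powr (s / 2) *\<^sub>R a i + e i powr (t / 2) *\<^sub>R b i))\<^sup>2 =
        e i powr s * inner (a i) (a i)
      + 2 * (e i powr ((s + t) / 2) * inner (a i) (b i)) + e i powr t * inner (b i) (b i)"
      by (simp add: power2_norm_eq_inner inner_add_left inner_add_right inner_commute
          algebra_simps)
  qed
  finally show ?thesis
    unfolding inner_geodesic a_def b_def by (simp add: sum.distrib sum_distrib_left)
qed

text \<open>Maximality of the geometric mean. With \<open>R = P\<^sup>-\<^sup>1 G\<close> the hypotheses say \<open>G P\<^sup>-\<^sup>1 G = Q\<close>;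
  the block form is tested at \<open>(- R x, x)\<close> for an eigenvector \<open>x\<close> of the pencil \<open>(Y, G)\<close>
  with the largest eigenvalue.\<close>

lemma riccati_maximal:
  fixes P Q G Y R :: "complex^'n^'n"
  assumes Y: "hermitian Y" and G: "pos_def G" and Q: "pos_def Q"
    and R: "P ** R = G" "G ** R = Q"
    and block: "\<And>u v. 0 \<le> inner u (P *v u) + 2 * inner u (Y *v v) + inner v (Q *v v)"
  shows "Y \<preceq>\<^sub>L G"
proof -
  have Gh: "hermitian G" and Gp: "\<And>x. x \<noteq> 0 \<Longrightarrow> 0 < inner x (G *v x)"
    using G by (auto simp: pos_def_iff)
  \<comment> \<open>An arbitrary nonzero vector, witnessing that the whole space is
    nontrivial.\<close>
  have nz: "axis undefined 1 \<noteq> (0 :: complex^'n)" by (simp add: axis_eq_0_iff)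
  obtain x l where x: "norm x = 1" "Y *v x = l *\<^sub>R (G *v x)"
    and l: "\<And>y. inner y (Y *v y) \<le> l * inner y (G *v y)"
    using generalized_eigenvector_exists[OF linear_matrix_vector_mult hermitian_inner[OF Y]
          linear_matrix_vector_mult hermitian_inner[OF Gh] Gp subspace_UNIV subset_UNIV
          subset_UNIV UNIV_I nz] by auto
  have "x \<noteq> 0" using x(1) by auto
  have GR: "inner (R *v x) (G *v x) = inner x (Q *v x)"
    using R(2) by (metis hermitian_inner[OF Gh] inner_commute matrix_vector_mul_assoc)
  have PR: "P *v (R *v x) = G *v x" using R(1) by (simp add: matrix_vector_mul_assoc)
  have "0 \<le> inner (- (R *v x)) (P *v (- (R *v x))) + 2 * inner (- (R *v x)) (Y *v x)
      + inner x (Q *v x)"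
    by (rule block)
  \<comment> \<open>The outer terms are both <x, Q x>, since P R = G and G R = Q; the middle one is
    -2 l <R x, G x> = -2 l <x, Q x>.\<close>
  also have "\<dots> = 2 * (1 - l) * inner x (Q *v x)"
    using GR PR x(2) by (simp add: linear_neg[OF linear_matrix_vector_mult] algebra_simps)
  finally have "0 \<le> 2 * (1 - l) * inner x (Q *v x)" .
  moreover have "0 < inner x (Q *v x)" using Q \<open>x \<noteq> 0\<close> by (simp add: pos_def_iff)
  ultimately have "l \<le> 1" by (simp add: zero_le_mult_iff)
  have "inner y (Y *v y) \<le> inner y (G *v y)" for y
  proof (cases "y = 0")
    case False
    have "l * inner y (G *v y) \<le> 1 * inner y (G *v y)"
      using \<open>l \<le> 1\<close> Gp[OF False] by (intro mult_right_mono) auto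
    with l[of y] show ?thesis by simp
  qed simp
  then show ?thesis using Y Gh by (intro loewner_leI)
qed

section \<open>Inverses, midpoints and comparison of curves\<close>

lemma conj_transpose_left_inverse:
  "T ** S = mat 1 \<Longrightarrow> conj_transpose S ** conj_transpose T = mat 1"
  by (metis conj_transpose_mat_1 conj_transpose_mult)

lemma pos_def_geodesic:
  fixes S T :: "complex^'n^'n"
  assumes "T ** S = mat 1" and e: "\<And>i. 0 < e i"
  shows "pos_def (geodesic S e t)"
  unfolding pos_def_iff
proof (intro conjI hermitian_geodesic allI impI)
  fix x :: "complex^'n" assume "x \<noteq> 0"
  have "conj_transpose T ** conj_transpose S = mat 1"
    using assms(1) by (simp add: matrix_left_right_inverse conj_transpose_left_inverse)
  then have "conj_transpose S *v x \<noteq> 0"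
    using \<open>x \<noteq> 0\<close> by (metis matrix_vector_mul_assoc matrix_vector_mul_lid matrix_vector_mult_0_right)
  then obtain i where i: "(conj_transpose S *v x) $ i \<noteq> 0" by (auto simp: vec_eq_iff)
  show "0 < inner x (geodesic S e t *v x)" unfolding inner_geodesic
    by (rule sum_pos2[of _ i]) (use i e in \<open>auto intro: mult_pos_pos simp: less_imp_neq[symmetric]\<close>)
qed

text \<open>The inner factors cancel and the exponents add. At s + t = 0 the product collapses to S
  T = 1, so \<open>geodesic (conj_transpose T) e\<close> at -s is the inverse of the curve at
  s.\<close>

lemma geodesic_mult_geodesic:
  assumes "T ** S = mat 1" and "\<And>i. 0 < e i"
  shows "geodesic S e s ** geodesic (conj_transpose T) e t = S ** diag_real (\<lambda>i. e i powr (s + t)) ** T"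
proof -
  have "geodesic S e s ** geodesic (conj_transpose T) e t =
    S ** (diag_real (\<lambda>i. e i powr s) ** ((conj_transpose S ** conj_transpose T)
      ** diag_real (\<lambda>i. e i powr t))) ** T"
    by (simp add: geodesic_def matrix_mul_assoc)
  then show ?thesis using assms by (simp add: conj_transpose_left_inverse powr_add)
qed

text \<open>The point at (s + t) / 2 is the geometric mean of the points at s and t, so the Riccati
  criterion applies.\<close>

lemma midpoint_maximal:
  fixes S T Y :: "complex^'n^'n"
  assumes T: "T ** S = mat 1" and e: "\<And>i. 0 < e i" and Y: "hermitian Y"
    and block: "\<And>u v. 0 \<le> inner u (geodesic S e s *v u) + 2 * inner u (Y *v v)
      + inner v (geodesic S e t *v v)"
  shows "Y \<preceq>\<^sub>L geodesic S e ((s + t) / 2)"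
proof -
  \<comment> \<open>Multiplying by \<open>R\<close> on the right shifts the parameter by (t - s) /
    2: from s to the midpoint and from the midpoint to t. These are the two equations that
    \<open>riccati_maximal\<close> asks for.\<close>
  define R where "R = conj_transpose T ** diag_real (\<lambda>i. e i powr ((t - s) / 2)) ** conj_transpose S"
  have R: "geodesic S e a ** R = geodesic S e (a + (t - s) / 2)" for a
  proof -
    have "geodesic S e a ** R = S ** (diag_real (\<lambda>i. e i powr a) **
        ((conj_transpose S ** conj_transpose T) ** diag_real (\<lambda>i. e i powr ((t - s) / 2))))
        ** conj_transpose S"
      by (simp add: geodesic_def R_def matrix_mul_assoc)
    then show ?thesis using T by (simp add: geodesic_def conj_transpose_left_inverse powr_add)
  qed
  show ?thesis
    using R[of s] R[of "(s + t) / 2"]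
    by (intro riccati_maximal[OF Y _ _ _ _ block] pos_def_geodesic[OF T e]) (simp_all add: field_simps)
qed

text \<open>The nearest points a \<le> t \<le> b of T on either side of t have their midpoint in T.
  On whichever side of t it lies, it would be nearer than a or b, unless that point is t
  itself.\<close>

lemma closed_midpoint_convex_Icc:
  fixes T :: "real set"
  assumes "closed T" "0 \<in> T" "1 \<in> T"
    and mid: "\<And>s t. s \<in> T \<Longrightarrow> t \<in> T \<Longrightarrow> (s + t) / 2 \<in> T"
  shows "{0..1} \<subseteq> T"
proof
  fix t :: real assume t: "t \<in> {0..1}"
  define a where "a = Sup (T \<inter> {0..t})"
  define b where "b = Inf (T \<inter> {t..1})"
  have a: "a \<in> T \<inter> {0..t}" unfolding a_def
    using assms t by (intro closed_contains_Sup closed_Int) auto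
  have b: "b \<in> T \<inter> {t..1}" unfolding b_def
    using assms t by (intro closed_contains_Inf closed_Int) auto
  have m: "(a + b) / 2 \<in> T" using a b mid by blast
  show "t \<in> T"
  proof (cases "(a + b) / 2 \<le> t")
    case True
    with m a b have "(a + b) / 2 \<le> a" unfolding a_def
      by (intro cSup_upper) (auto simp flip: a_def)
    with a b have "t = a" by auto
    with a show ?thesis by simp
  next
    case False
    with m a b have "b \<le> (a + b) / 2" unfolding b_def
      by (intro cInf_lower) (auto simp flip: b_def)
    with a b have "t = b" by auto
    with b show ?thesis by simp
  qed
qed

text \<open>The order at s and t passes to their midpoint: in \<open>geodesic_block_nonneg\<close>
  for the lower curve, raising the diagonal blocks to the upper curve keeps the form nonnegative,
  and \<open>midpoint_maximal\<close> then bounds the off-diagonal block. Invertibility is asked of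
  the upper factor \<open>S\<close> alone, because the lower curve will be built from X, which may
  be singular.\<close>

theorem geodesic_mono:
  fixes S T S' :: "complex^'n^'n"
  assumes T: "T ** S = mat 1" and e: "\<And>i. 0 < e i" and e': "\<And>i. 0 < e' i"
    and le0: "geodesic S' e' 0 \<preceq>\<^sub>L geodesic S e 0" and le1: "geodesic S' e' 1 \<preceq>\<^sub>L geodesic S e 1"
    and t: "0 \<le> t" "t \<le> 1"
  shows "geodesic S' e' t \<preceq>\<^sub>L geodesic S e t"
proof -
  have le_iff: "geodesic S' e' t \<preceq>\<^sub>L geodesic S e t \<longleftrightarrow>
      (\<forall>x. inner x (geodesic S' e' t *v x) \<le> inner x (geodesic S e t *v x))" for t
    by (simp add: loewner_le_def pos_semidef_iff hermitian_diff hermitian_geodesic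
        matrix_vector_mult_diff_rdistrib inner_diff_right)
  define C where "C = {t. geodesic S' e' t \<preceq>\<^sub>L geodesic S e t}"
  have "closed C"
    unfolding C_def le_iff Collect_all_eq
    by (intro closed_INT closed_Collect_le ballI continuous_on_inner_geodesic e e')
  moreover have "(s + t) / 2 \<in> C" if "s \<in> C" "t \<in> C" for s t
  proof -
    have "0 \<le> inner u (geodesic S e s *v u) + 2 * inner u (geodesic S' e' ((s + t) / 2) *v v)
      + inner v (geodesic S e t *v v)" for u v
      using that geodesic_block_nonneg[of e' u S' s t v, OF e'] unfolding C_def le_iff mem_Collect_eq
      by (smt (verit))
    then show ?thesis unfolding C_def mem_Collect_eq
      by (intro midpoint_maximal[OF T e hermitian_geodesic])
  qed
  ultimately have "{0..1} \<subseteq> C" using le0 le1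
    by (intro closed_midpoint_convex_Icc) (auto simp: C_def)
  then show ?thesis using t by (auto simp: C_def)
qed

section \<open>Geometric means of positive semidefinite matrices\<close>

lemma loewner_leD: "A \<preceq>\<^sub>L B \<Longrightarrow> inner x (A *v x) \<le> inner x (B *v x)"
  by (simp add: loewner_le_def pos_semidef_iff matrix_vector_mult_diff_rdistrib inner_diff_right)

lemma pos_def_imp_pos_semidef: "pos_def A \<Longrightarrow> pos_semidef A"
  by (metis inner_zero_left less_eq_real_def order_refl pos_def_iff pos_semidef_iff)

text \<open>Column i of U is a unit eigenvector for \<open>d i\<close>, so the sign of the quadratic
  form passes to the eigenvalues.\<close>

lemma diagonalisation_column:
  assumes "unitary U"
  shows "inner (U *v axis i 1) ((U ** diag_real d ** conj_transpose U) *v (U *v axis i 1)) = d i"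
proof -
  have "conj_transpose U *v (U *v axis i 1) = axis i 1"
    using assms by (simp add: matrix_vector_mul_assoc unitary_def)
  then have "inner (U *v axis i 1) ((U ** diag_real d ** conj_transpose U) *v (U *v axis i 1)) =
    (\<Sum>j\<in>UNIV. if j = i then d i else 0)"
    unfolding inner_diagonalised by (intro sum.cong) (auto simp: axis_def)
  then show ?thesis by simp
qed

lemma pos_semidef_diagonalisation:
  assumes "pos_semidef A"
  obtains U d where "unitary U" "\<And>i. 0 \<le> d i" "A = U ** diag_real d ** conj_transpose U"
proof -
  have "hermitian A" using assms by (simp add: pos_semidef_iff)
  then obtain U d where U: "unitary U" "A = U ** diag_real d ** conj_transpose U"
    by (rule hermitian_diagonalisation)
  have "0 \<le> d i" for i
    using diagonalisation_column[OF U(1), of i d] assms unfolding U(2) pos_semidef_iff by metis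
  then show ?thesis using U by (intro that)
qed

lemma pos_def_diagonalisation:
  fixes A :: "complex^'n^'n"
  assumes "pos_def A"
  obtains U d where "unitary U" "\<And>i. 0 < d i" "A = U ** diag_real d ** conj_transpose U"
proof -
  have "hermitian A" using assms by (simp add: pos_def_iff)
  then obtain U d where U: "unitary U" "A = U ** diag_real d ** conj_transpose U"
    by (rule hermitian_diagonalisation)
  have "0 < d i" for i
  proof -
    have "conj_transpose U *v (U *v axis i 1) = axis i 1"
      using U(1) by (simp add: matrix_vector_mul_assoc unitary_def)
    then have "U *v axis i 1 \<noteq> 0" by (auto simp: axis_eq_0_iff)
    then show ?thesis using diagonalisation_column[OF U(1), of i d] assms unfolding U(2) pos_def_iff
      by metis
  qed
  then show ?thesis using U by (intro that)
qed

section \<open>The weighted mean of definite matrices as a curve\<close>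

lemma pos_def_congruence:
  fixes B S T :: "complex^'n^'n"
  assumes "pos_def B" and T: "T ** S = mat 1"
  shows "pos_def (S ** B ** conj_transpose S)"
  unfolding pos_def_iff
proof (intro conjI allI impI)
  show "hermitian (S ** B ** conj_transpose S)"
    using assms by (intro hermitian_congruence) (simp add: pos_def_iff)
  fix x :: "complex^'n" assume "x \<noteq> 0"
  have "conj_transpose T ** conj_transpose S = mat 1"
    using T by (simp add: matrix_left_right_inverse conj_transpose_left_inverse)
  then have "conj_transpose S *v x \<noteq> 0"
    using \<open>x \<noteq> 0\<close> by (metis matrix_vector_mul_assoc matrix_vector_mul_lid matrix_vector_mult_0_right)
  moreover have "inner x ((S ** B ** conj_transpose S) *v x) =
      inner (conj_transpose S *v x) (B *v (conj_transpose S *v x))"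
    by (simp add: matrix_mul_assoc matrix_vector_mul_assoc flip: inner_adjoint)
  ultimately show "0 < inner x ((S ** B ** conj_transpose S) *v x)"
    using assms by (simp add: pos_def_iff)
qed

text \<open>Diagonalise C = A^(-1/2) B A^(-1/2) as V E V^*. The factor S = A^(1/2) V is the same for
  all t and gives A = S S^*, B = S E S^* and S E^t S^* for the mean.\<close>

lemma geom_mean_pd_geodesic:
  fixes A B :: "complex^'n^'n"
  assumes A: "pos_def A" and B: "pos_def B"
  obtains S T e where "T ** S = mat 1" "\<And>i. 0 < e i" "geodesic S e 0 = A" "geodesic S e 1 = B"
    "\<And>t. geom_mean_pd t A B = geodesic S e t"
proof -
  obtain W d where W: "unitary W" and d: "\<And>i. 0 < d i"
    and A_eq: "A = W ** diag_real d ** conj_transpose W"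
    by (rule pos_def_diagonalisation[OF A]) (rule that)
  have WW: "conj_transpose W ** W = mat 1" "W ** conj_transpose W = mat 1"
    using W by (auto simp: unitary_def)
  define p where "p a = W ** diag_real (\<lambda>i. d i powr a) ** conj_transpose W" for a
  have p: "matrix_powr A a = p a" for a
    unfolding matrix_powr_def A_eq p_def by (rule matrix_fun_diagonalisation[OF W])
  have pp: "p a ** p b = p (a + b)" for a b
  proof -
    have "p a ** p b = W ** (diag_real (\<lambda>i. d i powr a) **
        ((conj_transpose W ** W) ** diag_real (\<lambda>i. d i powr b))) ** conj_transpose W"
      by (simp add: p_def matrix_mul_assoc)
    then show ?thesis by (simp add: WW p_def powr_add)
  qed
  \<comment> \<open>Positivity of \<open>d\<close> matters: \<open>0 powr 0\<close> is 0, so a zero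
    eigenvalue would spoil the identity.\<close>
  have p0: "p 0 = mat 1" using d WW by (simp add: p_def less_imp_neq[symmetric])
  have p1: "p 1 = A" using d by (simp add: p_def A_eq less_imp_le)
  have p_herm: "conj_transpose (p a) = p a" for a
    by (simp add: p_def conj_transpose_mult matrix_mul_assoc)
  define C where "C = p (-1/2) ** B ** p (-1/2)"
  have "pos_def C"
    using pos_def_congruence[OF B, of "p (1/2)" "p (-1/2)"] by (simp add: C_def p_herm pp p0)
  then obtain V e where V: "unitary V" and e: "\<And>i. 0 < e i"
    and C_eq: "C = V ** diag_real e ** conj_transpose V"
    by (rule pos_def_diagonalisation) (rule that)
  have VV: "conj_transpose V ** V = mat 1" "V ** conj_transpose V = mat 1"
    using V by (auto simp: unitary_def)
  define S where "S = p (1/2) ** V"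
  define T where "T = conj_transpose V ** p (-1/2)"
  have G: "geodesic S e t = p (1/2) ** (V ** diag_real (\<lambda>i. e i powr t) ** conj_transpose V) ** p (1/2)"
    for t by (simp add: geodesic_def S_def conj_transpose_mult p_herm matrix_mul_assoc)
  show ?thesis
  proof (rule that[of T S e])
    have "T ** S = conj_transpose V ** (p (-1/2) ** p (1/2)) ** V"
      by (simp add: S_def T_def matrix_mul_assoc)
    then show "T ** S = mat 1" by (simp add: pp p0 VV)
    show "0 < e i" for i by (rule e)
    show "geodesic S e 0 = A"
      using e by (simp add: G less_imp_neq[symmetric] VV pp p1)
    have "geodesic S e 1 = p (1/2) ** C ** p (1/2)"
      using e by (simp add: G C_eq less_imp_le)
    also have "\<dots> = (p (1/2) ** p (-1/2)) ** B ** (p (-1/2) ** p (1/2))"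
      by (simp add: C_def matrix_mul_assoc)
    finally show "geodesic S e 1 = B" by (simp add: pp p0)
    show "geom_mean_pd t A B = geodesic S e t" for t
      unfolding geom_mean_pd_def p G C_def[symmetric]
      unfolding matrix_powr_def C_eq matrix_fun_diagonalisation[OF V] ..
  qed
qed

text \<open>Both means are curves whose end points are compared by hypothesis. The case A = C =
  \<open>mat 1\<close> is the Loewner-Heinz inequality for definite matrices.\<close>

lemma geom_mean_pd_mono:
  assumes "pos_def A" "pos_def B" "pos_def C" "pos_def D" "A \<preceq>\<^sub>L C" "B \<preceq>\<^sub>L D" "0 \<le> t" "t \<le> 1"
  shows "geom_mean_pd t A B \<preceq>\<^sub>L geom_mean_pd t C D"
proof -
  obtain S T e where S: "T ** S = mat 1" "\<And>i. 0 < e i" "geodesic S e 0 = C" "geodesic S e 1 = D"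
    "\<And>t. geom_mean_pd t C D = geodesic S e t"
    by (rule geom_mean_pd_geodesic[OF assms(3,4)]) (rule that)
  obtain S' T' e' where S': "T' ** S' = mat 1" "\<And>i. 0 < e' i" "geodesic S' e' 0 = A" "geodesic S' e' 1 = B"
    "\<And>t. geom_mean_pd t A B = geodesic S' e' t"
    by (rule geom_mean_pd_geodesic[OF assms(1,2)]) (rule that)
  show ?thesis
    unfolding S(5) S'(5)
    by (rule geodesic_mono[OF S(1,2) S'(2) _ _ assms(7,8)]) (simp_all add: S(3,4) S'(3,4) assms(5,6))
qed

lemma pos_def_geom_mean_pd:
  assumes "pos_def A" "pos_def B"
  shows "pos_def (geom_mean_pd t A B)"
  by (rule geom_mean_pd_geodesic[OF assms]) (simp add: pos_def_geodesic)

section \<open>Perturbations and limits of matrices\<close>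

lemma perturb_mult_vec: "(A + r *\<^sub>R mat 1) *v x = A *v x + r *\<^sub>R x" for A :: "complex^'n^'n"
proof -
  have "(r *\<^sub>R mat 1) *v x = r *\<^sub>R x"
    by (simp add: vec_eq_iff matrix_vector_mult_def mat_def if_distribR if_distrib
        cong: if_cong)
  then show ?thesis by (simp add: matrix_vector_mult_add_rdistrib)
qed

lemma hermitian_perturb: "hermitian A \<Longrightarrow> hermitian (A + r *\<^sub>R mat 1)"
  by (auto simp: hermitian_def conj_transpose_def vec_eq_iff mat_def)

lemma pos_def_perturb:
  assumes "pos_semidef A" "0 < r"
  shows "pos_def (A + r *\<^sub>R mat 1)"
  using assms
  by (auto simp: pos_def_iff pos_semidef_iff hermitian_perturb perturb_mult_vec inner_add_right
      intro: add_nonneg_pos)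

lemma tendsto_inner_matrix:
  fixes M :: "'b \<Rightarrow> complex^'n^'m"
  assumes "(M \<longlongrightarrow> L) F"
  shows "((\<lambda>z. inner x (M z *v y)) \<longlongrightarrow> inner x (L *v y)) F"
  unfolding inner_vec_def matrix_vector_mult_def vec_lambda_beta
  by (intro tendsto_intros tendsto_vec_nth assms)

lemma hermitian_limit:
  fixes M :: "'b \<Rightarrow> complex^'n^'n"
  assumes M: "(M \<longlongrightarrow> L) F" and "F \<noteq> bot" and herm: "\<forall>\<^sub>F z in F. hermitian (M z)"
  shows "hermitian L"
proof -
  have "cnj (L $ j $ i) = L $ i $ j" for i j
  proof (rule tendsto_unique[OF \<open>F \<noteq> bot\<close>])
    show "((\<lambda>z. M z $ i $ j) \<longlongrightarrow> L $ i $ j) F" by (intro tendsto_vec_nth M)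
    have "((\<lambda>z. cnj (M z $ j $ i)) \<longlongrightarrow> cnj (L $ j $ i)) F" by (intro tendsto_cnj tendsto_vec_nth M)
    then show "((\<lambda>z. M z $ i $ j) \<longlongrightarrow> cnj (L $ j $ i)) F"
      by (rule Lim_transform_eventually)
         (use herm in \<open>eventually_elim, auto simp: hermitian_def conj_transpose_def vec_eq_iff\<close>)
  qed
  then show ?thesis by (simp add: hermitian_def conj_transpose_def vec_eq_iff)
qed

text \<open>Polarisation: for Hermitian M the real bilinear form <x, M y> is symmetric, hence
  determined by its quadratic form, and the entries of M can be read off from it.\<close>

lemma quadratic_forms_converge_imp_tendsto:
  fixes M :: "'b \<Rightarrow> complex^'n^'n"
  assumes herm: "\<forall>\<^sub>F z in F. hermitian (M z)"
    and lim: "\<And>x. \<exists>l. ((\<lambda>z. inner x (M z *v x)) \<longlongrightarrow> l) F"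
  shows "\<exists>L. (M \<longlongrightarrow> L) F"
proof -
  obtain q where q: "\<And>x. ((\<lambda>z. inner x (M z *v x)) \<longlongrightarrow> q x) F"
    using lim by metis
  define b where "b x y = (q (x + y) - q x - q y) / 2" for x y
  have b: "((\<lambda>z. inner x (M z *v y)) \<longlongrightarrow> b x y) F" for x y
  proof (rule Lim_transform_eventually)
    show "((\<lambda>z. (inner (x + y) (M z *v (x + y)) - inner x (M z *v x) - inner y (M z *v y)) / 2)
        \<longlongrightarrow> b x y) F"
      unfolding b_def by (intro tendsto_intros q) simp
    show "\<forall>\<^sub>F z in F. (inner (x + y) (M z *v (x + y)) - inner x (M z *v x) - inner y (M z *v y)) / 2
        = inner x (M z *v y)"
      using herm
    proof eventually_elim
      case (elim z)
      have "inner y (M z *v x) = inner x (M z *v y)"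
        using hermitian_inner[OF elim] by (metis inner_commute)
      then show ?case by (simp add: matrix_vector_right_distrib inner_add_left inner_add_right)
    qed
  qed
  \<comment> \<open>Pairing with \<open>axis i 1\<close> yields the real part of the entry, pairing
    with \<open>axis i \<i>\<close> its imaginary part.\<close>
  have entry: "M z $ i $ j = Complex (inner (axis i 1) (M z *v axis j 1)) (inner (axis i \<i>) (M z *v axis j 1))"
    for z i j
    unfolding inner_axis'
    by (simp add: matrix_vector_mult_def axis_def if_distrib inner_complex_def cong: if_cong)
  have "((\<lambda>z. M z $ i $ j) \<longlongrightarrow> Complex (b (axis i 1) (axis j 1)) (b (axis i \<i>) (axis j 1))) F" for i j
    unfolding entry by (intro tendsto_Complex b)
  then have "(M \<longlongrightarrow> (\<chi> i j. Complex (b (axis i 1) (axis j 1)) (b (axis i \<i>) (axis j 1)))) F"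
    by (intro vec_tendstoI) simp
  then show ?thesis by blast
qed

lemma mono_tendsto_at_right:
  fixes f :: "real \<Rightarrow> real"
  assumes mono: "\<And>r s. a < r \<Longrightarrow> r \<le> s \<Longrightarrow> f r \<le> f s" and bound: "\<And>r. a < r \<Longrightarrow> c \<le> f r"
  shows "(f \<longlongrightarrow> Inf (f ` {a<..})) (at_right a)"
proof (rule decreasing_tendsto)
  have bdd: "bdd_below (f ` {a<..})" using bound by (auto intro!: bdd_belowI)
  then show "\<forall>\<^sub>F r in at_right a. Inf (f ` {a<..}) \<le> f r"
    by (auto simp: eventually_at_filter intro!: cInf_lower always_eventually)
  fix x assume "Inf (f ` {a<..}) < x"
  then obtain r where r: "a < r" "f r < x"
    using bdd by (subst (asm) cInf_less_iff) auto
  show "\<forall>\<^sub>F s in at_right a. f s < x"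
    using eventually_at_right_less[of a] eventually_at_right_real[OF r(1)]
    by eventually_elim (use mono[of _ r] r in \<open>fastforce intro: le_less_trans\<close>)
qed

text \<open>\<open>Lim\<close> says something only once the limit exists. The perturbed means
  increase with r and are positive, so each quadratic form decreases to a limit as r tends to 0 from
  the right. \<open>npd\<close> selects the branch of \<open>geom_mean\<close> defined by this
  limit.\<close>

lemma geom_mean_tendsto:
  fixes A B :: "complex^'n^'n"
  assumes A: "pos_semidef A" and B: "pos_semidef B" and t: "0 \<le> t" "t \<le> 1"
    and npd: "\<not> (pos_def A \<and> pos_def B)"
  shows "((\<lambda>r. geom_mean_pd t (A + r *\<^sub>R mat 1) (B + r *\<^sub>R mat 1)) \<longlongrightarrow> geom_mean t A B)
    (at_right 0)"
proof -
  define M where "M r = geom_mean_pd t (A + r *\<^sub>R mat 1) (B + r *\<^sub>R mat 1)" for r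
  have pd: "pos_def (M r)" if "0 < r" for r
    unfolding M_def using that A B by (intro pos_def_geom_mean_pd pos_def_perturb)
  have mono: "M r \<preceq>\<^sub>L M s" if "0 < r" "r \<le> s" for r s
    unfolding M_def using that A B t
    by (intro geom_mean_pd_mono pos_def_perturb loewner_leI hermitian_perturb)
       (auto simp: pos_semidef_iff perturb_mult_vec inner_add_right mult_right_mono)
  have "\<exists>L. (M \<longlongrightarrow> L) (at_right 0)"
  proof (rule quadratic_forms_converge_imp_tendsto)
    show "\<forall>\<^sub>F z in at_right 0. hermitian (M z)"
      using eventually_at_right_less[of "0::real"] pd by (auto elim!: eventually_mono simp: pos_def_iff)
    show "\<exists>l. ((\<lambda>r. inner x (M r *v x)) \<longlongrightarrow> l) (at_right 0)" for x
      using mono_tendsto_at_right[of 0 "\<lambda>r. inner x (M r *v x)" 0] loewner_leD[OF mono]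
        pos_def_imp_pos_semidef[OF pd] by (auto simp: pos_semidef_iff)
  qed
  then obtain L where L: "(M \<longlongrightarrow> L) (at_right 0)" by blast
  then have "geom_mean t A B = L"
    using npd by (simp add: geom_mean_def M_def[abs_def] tendsto_Lim del: de_Morgan_conj)
  with L show ?thesis by (simp add: M_def[abs_def])
qed

section \<open>Block matrices and maximality of the geometric mean\<close>

text \<open>\<open>block\<close> and \<open>block'\<close> are the two halves of the PPT condition
  as forms in a pair of vectors; \<open>block\<close> yields the end point t = 0 of the comparison
  of curves, \<open>block'\<close> the end point t = 1.\<close>

lemma geom_mean_pd_block:
  fixes A B X :: "complex^'n^'n"
  assumes A: "pos_def A" and B: "pos_def B" and t: "0 \<le> t" "t \<le> 1"
    and block: "\<And>x y. 0 \<le> inner x (A *v x) + 2 * inner y (X *v x) + inner y (B *v y)"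
    and block': "\<And>x y. 0 \<le> inner x (A *v x) + 2 * inner x (X *v y) + inner y (B *v y)"
  shows "0 \<le> inner x (geom_mean_pd t A B *v x) + 2 * inner y (X *v x)
    + inner y (geom_mean_pd (1 - t) A B *v y)"
proof -
  obtain S T e where T: "T ** S = mat 1" and e: "\<And>i. 0 < e i"
    and G0: "geodesic S e 0 = A" and G1: "geodesic S e 1 = B"
    and G: "\<And>t. geom_mean_pd t A B = geodesic S e t"
    by (rule geom_mean_pd_geodesic[OF A B]) (rule that)
  \<comment> \<open>\<open>H t\<close> is the inverse of \<open>geodesic S e t\<close>.\<close>
  define H where "H t = geodesic (conj_transpose T) e (- t)" for t
  have GH: "geodesic S e t ** H t = mat 1" for t
  proof -
    have "geodesic S e t ** H t = S ** T"
      using e by (simp add: H_def geodesic_mult_geodesic[OF T e] less_imp_neq[symmetric])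
    then show ?thesis using T by (simp add: matrix_left_right_inverse)
  qed
  then have HG: "H t ** geodesic S e t = mat 1" for t by (simp add: matrix_left_right_inverse)
  \<comment> \<open>The factor e^(-1/2) enters the curve twice and turns e^t into e^(t - 1), the
    exponent of the inverse mean at 1 - t.\<close>
  define S' where "S' = conj_transpose X ** conj_transpose T ** diag_real (\<lambda>i. e i powr (- 1/2))"
  have K_eq: "geodesic S' e t = conj_transpose X ** H (1 - t) ** X" for t
  proof -
    have "geodesic S' e t = conj_transpose X ** conj_transpose T ** (diag_real (\<lambda>i. e i powr (- 1/2)) **
        diag_real (\<lambda>i. e i powr t) ** diag_real (\<lambda>i. e i powr (- 1/2))) ** T ** X"
      by (simp only: geodesic_def S'_def conj_transpose_mult conj_transpose_diag_real
          conj_transpose_conj_transpose matrix_mul_assoc)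
    also have "diag_real (\<lambda>i. e i powr (- 1/2)) ** diag_real (\<lambda>i. e i powr t) **
        diag_real (\<lambda>i. e i powr (- 1/2)) = diag_real (\<lambda>i. e i powr (- (1 - t)))"
      by (simp flip: powr_add)
    finally show ?thesis by (simp add: H_def geodesic_def matrix_mul_assoc)
  qed
  have K: "inner x (geodesic S' e t *v x) = inner (X *v x) (H (1 - t) *v (X *v x))" for x t
    unfolding K_eq by (simp add: inner_adjoint[of x "conj_transpose X"] flip: matrix_vector_mul_assoc)
  have neg: "M *v (- v) = - (M *v v)" for M :: "complex^'n^'n" and v
    by (rule linear_neg[OF linear_matrix_vector_mult])
  have AH: "A *v (H 0 *v z) = z" "B *v (H 1 *v z) = z" for z
    using GH[of 0] GH[of 1] by (simp_all add: G0 G1 matrix_vector_mul_assoc)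
  have "geodesic S' e 0 \<preceq>\<^sub>L geodesic S e 0"
  proof (rule loewner_leI[OF hermitian_geodesic hermitian_geodesic])
    \<comment> \<open>\<open>H 1\<close> is the inverse of B, so the test vector -B^-1 X x minimises
      the form for given x and leaves the Schur complement. The other end point uses
      \<open>H 0\<close>, the inverse of A, in the same way.\<close>
    fix x show "inner x (geodesic S' e 0 *v x) \<le> inner x (geodesic S e 0 *v x)"
      using block[of x "- (H 1 *v (X *v x))"] by (simp add: K G0 neg AH inner_commute)
  qed
  moreover have "geodesic S' e 1 \<preceq>\<^sub>L geodesic S e 1"
  proof (rule loewner_leI[OF hermitian_geodesic hermitian_geodesic])
    fix y show "inner y (geodesic S' e 1 *v y) \<le> inner y (geodesic S e 1 *v y)"
      using block'[of "- (H 0 *v (X *v y))" y] by (simp add: K G1 neg AH inner_commute)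
  qed
  ultimately have "geodesic S' e t \<preceq>\<^sub>L geodesic S e t"
    by (intro geodesic_mono[OF T e e _ _ t])
  then have le: "inner (X *v x) (H (1 - t) *v (X *v x)) \<le> inner x (geodesic S e t *v x)"
    unfolding K[symmetric] by (rule loewner_leD)
  define z where "z = X *v x"
  define w where "w = geodesic S e (1 - t) *v y"
  have Hw: "H (1 - t) *v w = y" and Gz: "geodesic S e (1 - t) *v (H (1 - t) *v z) = z"
    by (simp_all add: w_def matrix_vector_mul_assoc GH HG)
  \<comment> \<open>Completing the square: positivity of the inverse mean \<open>H (1 - t)\<close>
    produces the desired form with <z, H z> in place of the mean at t, and \<open>le\<close> bounds
    that term.\<close>
  have "0 \<le> inner (w + z) (H (1 - t) *v (w + z))"
    unfolding H_def inner_geodesic by (intro sum_nonneg mult_nonneg_nonneg) auto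
  also have "\<dots> = inner y (geodesic S e (1 - t) *v y) + 2 * inner y z + inner z (H (1 - t) *v z)"
  proof -
    have "inner w (H (1 - t) *v z) = inner y z"
      unfolding w_def by (metis Gz hermitian_geodesic hermitian_inner)
    then show ?thesis
      by (simp add: matrix_vector_right_distrib Hw inner_add_left inner_add_right inner_commute)
         (simp add: w_def inner_commute)
  qed
  finally show ?thesis using le by (simp add: G z_def)
qed

lemma pos_semidef_limit:
  fixes M :: "'b \<Rightarrow> complex^'n^'n"
  assumes "(M \<longlongrightarrow> L) F" "F \<noteq> bot" "\<forall>\<^sub>F z in F. pos_semidef (M z)"
  shows "pos_semidef L"
  unfolding pos_semidef_iff
proof (intro conjI allI)
  show "hermitian L"
    using assms(3) by (intro hermitian_limit[OF assms(1,2)]) (auto simp: pos_semidef_iff elim: eventually_mono)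
  show "0 \<le> inner x (L *v x)" for x
    using assms(3)
    by (intro tendsto_lowerbound[OF tendsto_inner_matrix[OF assms(1)] _ assms(2)])
       (auto simp: pos_semidef_iff elim: eventually_mono)
qed

lemma pos_semidef_geom_mean:
  assumes A: "pos_semidef A" and B: "pos_semidef B" and t: "0 \<le> t" "t \<le> 1"
  shows "pos_semidef (geom_mean t A B)"
proof (cases "pos_def A \<and> pos_def B")
  case True
  then show ?thesis by (simp add: geom_mean_def pos_def_geom_mean_pd pos_def_imp_pos_semidef)
next
  case False
  have "\<forall>\<^sub>F r in at_right 0. pos_semidef (geom_mean_pd t (A + r *\<^sub>R mat 1) (B + r *\<^sub>R mat 1))"
    using eventually_at_right_less[of "0::real"]
    by eventually_elim (intro pos_def_imp_pos_semidef pos_def_geom_mean_pd pos_def_perturb A B)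
  then show ?thesis
    by (rule pos_semidef_limit[OF geom_mean_tendsto[OF A B t False] trivial_limit_at_right_real])
qed

text \<open>Perturbing A and B adds the nonnegative r (<x, x> + <y, y>) to both block forms, so the
  definite case applies for every r > 0, and the inequality survives the limit.\<close>

lemma geom_mean_block:
  fixes A B X :: "complex^'n^'n"
  assumes A: "pos_semidef A" and B: "pos_semidef B" and t: "0 \<le> t" "t \<le> 1"
    and block: "\<And>x y. 0 \<le> inner x (A *v x) + 2 * inner y (X *v x) + inner y (B *v y)"
    and block': "\<And>x y. 0 \<le> inner x (A *v x) + 2 * inner x (X *v y) + inner y (B *v y)"
  shows "0 \<le> inner x (geom_mean t A B *v x) + 2 * inner y (X *v x)
    + inner y (geom_mean (1 - t) A B *v y)"
proof (cases "pos_def A \<and> pos_def B")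
  case True
  then show ?thesis using geom_mean_pd_block[OF _ _ t block block'] by (simp add: geom_mean_def)
next
  case False
  let ?M = "\<lambda>t r. geom_mean_pd t (A + r *\<^sub>R mat 1) (B + r *\<^sub>R mat 1)"
  show ?thesis
  proof (rule tendsto_lowerbound[OF _ _ trivial_limit_at_right_real])
    show "((\<lambda>r. inner x (?M t r *v x) + 2 * inner y (X *v x) + inner y (?M (1 - t) r *v y)) \<longlongrightarrow>
        inner x (geom_mean t A B *v x) + 2 * inner y (X *v x)
        + inner y (geom_mean (1 - t) A B *v y)) (at_right 0)"
      using t by (intro tendsto_intros tendsto_inner_matrix geom_mean_tendsto A B False) auto
    show "\<forall>\<^sub>F r in at_right 0.
        0 \<le> inner x (?M t r *v x) + 2 * inner y (X *v x) + inner y (?M (1 - t) r *v y)"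
      using eventually_at_right_less[of "0::real"]
    proof eventually_elim
      case (elim r)
      have pert: "inner u ((C + r *\<^sub>R mat 1) *v u) = inner u (C *v u) + r * inner u u"
        "0 \<le> r * inner u u" for u and C :: "complex^'n^'n"
        using elim by (simp_all add: perturb_mult_vec inner_add_right)
      show ?case
      proof (rule geom_mean_pd_block[OF pos_def_perturb[OF A elim] pos_def_perturb[OF B elim] t])
        show "0 \<le> inner u ((A + r *\<^sub>R mat 1) *v u) + 2 * inner v (X *v u)
            + inner v ((B + r *\<^sub>R mat 1) *v v)" for u v
          using block[of u v] pert(2)[of u] pert(2)[of v] by (simp add: pert(1))
        show "0 \<le> inner u ((A + r *\<^sub>R mat 1) *v u) + 2 * inner u (X *v v)
            + inner v ((B + r *\<^sub>R mat 1) *v v)" for u v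
          using block'[of u v] pert(2)[of u] pert(2)[of v] by (simp add: pert(1))
      qed
    qed
  qed
qed

text \<open>The mean is the midpoint of the curve from P at 0 to Q at 1.\<close>

lemma geom_mean_pd_maximal:
  fixes P Q Y :: "complex^'n^'n"
  assumes "pos_def P" "pos_def Q" "hermitian Y"
    and "\<And>x y. 0 \<le> inner x (P *v x) + 2 * inner x (Y *v y) + inner y (Q *v y)"
  shows "Y \<preceq>\<^sub>L geom_mean_pd (1/2) P Q"
proof -
  obtain S T e where T: "T ** S = mat 1" and e: "\<And>i. 0 < e i"
    and G0: "geodesic S e 0 = P" and G1: "geodesic S e 1 = Q"
    and G: "\<And>t. geom_mean_pd t P Q = geodesic S e t"
    by (rule geom_mean_pd_geodesic[OF assms(1,2)]) (rule that)
  show ?thesis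
    using midpoint_maximal[OF T e assms(3), where s = 0 and t = 1] assms(4) by (simp add: G G0 G1)
qed

lemma geom_mean_maximal:
  fixes P Q Y :: "complex^'n^'n"
  assumes P: "pos_semidef P" and Q: "pos_semidef Q" and Y: "hermitian Y"
    and block: "\<And>x y. 0 \<le> inner x (P *v x) + 2 * inner x (Y *v y) + inner y (Q *v y)"
  shows "Y \<preceq>\<^sub>L geom_mean (1/2) P Q"
proof (cases "pos_def P \<and> pos_def Q")
  case True
  then show ?thesis using geom_mean_pd_maximal[OF _ _ Y block] by (simp add: geom_mean_def)
next
  case False
  let ?M = "\<lambda>r. geom_mean_pd (1/2) (P + r *\<^sub>R mat 1) (Q + r *\<^sub>R mat 1)"
  have "\<forall>\<^sub>F r in at_right 0. pos_semidef (?M r - Y)"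
    using eventually_at_right_less[of "0::real"]
  proof eventually_elim
    case (elim r)
    have pert: "inner u ((C + r *\<^sub>R mat 1) *v u) = inner u (C *v u) + r * inner u u"
      "0 \<le> r * inner u u" for u and C :: "complex^'n^'n"
      using elim by (simp_all add: perturb_mult_vec inner_add_right)
    have "0 \<le> inner u ((P + r *\<^sub>R mat 1) *v u) + 2 * inner u (Y *v v)
        + inner v ((Q + r *\<^sub>R mat 1) *v v)" for u v
      using block[of u v] pert(2)[of u] pert(2)[of v] by (simp add: pert(1))
    then have "Y \<preceq>\<^sub>L ?M r"
      by (intro geom_mean_pd_maximal pos_def_perturb P Q Y elim)
    then show ?case by (simp add: loewner_le_def)
  qed
  moreover have "((\<lambda>r. ?M r - Y) \<longlongrightarrow> geom_mean (1/2) P Q - Y) (at_right 0)"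
    by (intro tendsto_intros geom_mean_tendsto P Q False) auto
  ultimately show ?thesis unfolding loewner_le_def
    by (intro pos_semidef_limit[OF _ trivial_limit_at_right_real])
qed

section \<open>Block matrices as quadratic forms in pairs of vectors\<close>

definition block_vector :: "complex^'n \<Rightarrow> complex^'n \<Rightarrow> complex^('n + 'n)"
  where "block_vector x y = (\<chi> k. case k of Inl i \<Rightarrow> x $ i | Inr i \<Rightarrow> y $ i)"

lemma sum_UNIV_Plus:
  fixes f :: "'a::finite + 'b::finite \<Rightarrow> 'c::comm_monoid_add"
  shows "sum f UNIV = (\<Sum>i\<in>UNIV. f (Inl i)) + (\<Sum>i\<in>UNIV. f (Inr i))"
  by (simp add: sum.Plus flip: UNIV_Plus_UNIV)

lemma block_matrix_mult_vec:
  "block_matrix A B C D *v block_vector x y =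
    block_vector (A *v x + B *v y) (C *v x + D *v y)"
  by (auto simp: vec_eq_iff block_matrix_def block_vector_def matrix_vector_mult_def sum_UNIV_Plus
      split: sum.split)

lemma inner_block_vector: "inner (block_vector x y) (block_vector u v) = inner x u + inner y v"
  by (simp add: inner_vec_def block_vector_def sum_UNIV_Plus)

text \<open>The off-diagonal blocks are mutually adjoint and contribute equally to the real form,
  whence the factor 2. Setting one of the two vectors to 0 isolates a diagonal block.\<close>

lemma pos_semidef_block:
  assumes "pos_semidef (block_matrix A (conj_transpose X) X B)"
  shows "pos_semidef A" "pos_semidef B"
    and "0 \<le> inner x (A *v x) + 2 * inner y (X *v x) + inner y (B *v y)"
proof -
  have q: "0 \<le> inner x (A *v x) + 2 * inner y (X *v x) + inner y (B *v y)" for x y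
  proof -
    have "inner x (conj_transpose X *v y) = inner y (X *v x)"
      using inner_adjoint[of y X x] by (simp add: inner_commute)
    moreover have "0 \<le> inner (block_vector x y) (block_matrix A (conj_transpose X) X B *v block_vector x y)"
      using assms by (simp add: pos_semidef_iff)
    ultimately show ?thesis
      by (simp add: block_matrix_mult_vec inner_block_vector inner_add_right)
  qed
  have h: "cnj (block_matrix A (conj_transpose X) X B $ j $ i) =
      block_matrix A (conj_transpose X) X B $ i $ j" for i j
    using assms by (simp add: pos_semidef_iff hermitian_def conj_transpose_def vec_eq_iff)
  show "pos_semidef A" unfolding pos_semidef_iff
    using h[of "Inl _" "Inl _"] q[of _ 0]
    by (simp add: hermitian_def conj_transpose_def vec_eq_iff block_matrix_def)
  show "pos_semidef B" unfolding pos_semidef_iff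
    using h[of "Inr _" "Inr _"] q[of 0]
    by (simp add: hermitian_def conj_transpose_def vec_eq_iff block_matrix_def)
  show "0 \<le> inner x (A *v x) + 2 * inner y (X *v x) + inner y (B *v y)" by (rule q)
qed

section \<open>The absolute value and the polar decomposition\<close>

lemma pos_semidef_conj_transpose_mult: "pos_semidef (conj_transpose X ** X)"
  by (simp add: pos_semidef_iff hermitian_def conj_transpose_mult
      inner_adjoint[of _ "conj_transpose X"] flip: matrix_vector_mul_assoc)

lemma matrix_abs_diagonalisation:
  assumes "unitary W" and "conj_transpose X ** X = W ** diag_real d ** conj_transpose W"
  shows "matrix_abs X = W ** diag_real (\<lambda>i. d i powr (1/2)) ** conj_transpose W"
  unfolding matrix_abs_def matrix_powr_def assms(2) by (rule matrix_fun_diagonalisation[OF assms(1)])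

lemma hermitian_matrix_abs: "hermitian (matrix_abs X)"
proof -
  obtain W d where "unitary W" "conj_transpose X ** X = W ** diag_real d ** conj_transpose W"
    by (rule pos_semidef_diagonalisation[OF pos_semidef_conj_transpose_mult]) (rule that)
  then show ?thesis
    by (simp add: matrix_abs_diagonalisation hermitian_congruence hermitian_def[of "diag_real _"])
qed

text \<open>X X^* = U |X|^2 U^*, so if W diagonalises X^* X, then U W diagonalises X X^* with the
  same eigenvalues, and the square roots are conjugate by U as well.\<close>

lemma matrix_abs_conj_transpose:
  assumes U: "unitary U" and X: "X = U ** matrix_abs X"
  shows "matrix_abs (conj_transpose X) = U ** matrix_abs X ** conj_transpose U"
proof -
  obtain W d where W: "unitary W" and d: "\<And>i. 0 \<le> d i"
    and XX: "conj_transpose X ** X = W ** diag_real d ** conj_transpose W"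
    by (rule pos_semidef_diagonalisation[OF pos_semidef_conj_transpose_mult]) (rule that)
  have abs_X: "matrix_abs X = W ** diag_real (\<lambda>i. d i powr (1/2)) ** conj_transpose W"
    using W XX by (rule matrix_abs_diagonalisation)
  have WW: "conj_transpose W ** W = mat 1" "W ** conj_transpose W = mat 1"
    and UU: "conj_transpose U ** U = mat 1" "U ** conj_transpose U = mat 1"
    using W U by (auto simp: unitary_def)
  have "conj_transpose (U ** W) ** (U ** W) = conj_transpose W ** (conj_transpose U ** U) ** W"
    "(U ** W) ** conj_transpose (U ** W) = U ** (W ** conj_transpose W) ** conj_transpose U"
    by (simp_all add: conj_transpose_mult matrix_mul_assoc)
  then have UW: "unitary (U ** W)" by (simp add: unitary_def UU WW)
  have "X ** conj_transpose X =
      (U ** matrix_abs X) ** conj_transpose (U ** matrix_abs X)"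
    unfolding X[symmetric] ..
  also have "\<dots> = U ** W ** (diag_real (\<lambda>i. d i powr (1/2)) ** (conj_transpose W ** W) **
      diag_real (\<lambda>i. d i powr (1/2))) ** conj_transpose W ** conj_transpose U"
    by (simp only: abs_X conj_transpose_mult matrix_mul_assoc conj_transpose_diag_real
        conj_transpose_conj_transpose)
  also have "\<dots> = (U ** W) ** diag_real d ** conj_transpose (U ** W)"
    using d by (simp add: WW conj_transpose_mult matrix_mul_assoc flip: powr_add)
  finally have "conj_transpose (conj_transpose X) ** conj_transpose X =
      (U ** W) ** diag_real d ** conj_transpose (U ** W)" by simp
  from matrix_abs_diagonalisation[OF UW this] show ?thesis
    by (simp only: abs_X conj_transpose_mult matrix_mul_assoc)
qed

lemma pos_semidef_congruence:
  assumes "pos_semidef B"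
  shows "pos_semidef (S ** B ** conj_transpose S)"
  using assms
  by (simp add: pos_semidef_iff hermitian_congruence inner_adjoint[of _ S]
      flip: matrix_vector_mul_assoc)

theorem corollary2p1:
  fixes A B X U :: "complex^'n^'n"
    and t :: real
  assumes "ppt_block A X B"
    and "unitary U"
    and "X = U ** matrix_abs X"
    and "0 \<le> t" and "t \<le> 1"
  shows "matrix_abs X \<preceq>\<^sub>L
      geom_mean (1/2) (geom_mean t A B)
        (conj_transpose U ** geom_mean (1 - t) A B ** U)
    \<and> matrix_abs (conj_transpose X) \<preceq>\<^sub>L
      geom_mean (1/2) (U ** geom_mean t A B ** conj_transpose U)
        (geom_mean (1 - t) A B)"
proof -
  define P where "P = geom_mean t A B"
  define Q where "Q = geom_mean (1 - t) A B"
  define Y where "Y = matrix_abs X"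
  have X: "X = U ** Y" unfolding Y_def by (rule assms(3))
  have Y: "hermitian Y" by (simp add: Y_def hermitian_matrix_abs)
  \<comment> \<open>The second half of PPT is the first with \<open>conj_transpose X\<close> in
    place of \<open>X\<close>; the double transpose makes \<open>pos_semidef_block\<close>
    applicable to both.\<close>
  have ppt: "pos_semidef (block_matrix A (conj_transpose X) X B)"
    "pos_semidef (block_matrix A (conj_transpose (conj_transpose X)) (conj_transpose X) B)"
    using assms(1) by (simp_all add: ppt_block_def)
  note AB = pos_semidef_block(1,2)[OF ppt(1)]
  have P: "pos_semidef P" and Q: "pos_semidef Q"
    unfolding P_def Q_def using assms(4,5) by (simp_all add: pos_semidef_geom_mean AB)
  have "0 \<le> inner x (A *v x) + 2 * inner x (X *v y) + inner y (B *v y)" for x y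
    using pos_semidef_block(3)[OF ppt(2), of x y] inner_adjoint[of x X y]
    by (simp add: inner_commute[of y])
  then have block: "0 \<le> inner x (P *v x) + 2 * inner y (X *v x) + inner y (Q *v y)" for x y
    unfolding P_def Q_def
    by (rule geom_mean_block[OF AB assms(4,5) pos_semidef_block(3)[OF ppt(1)]])
  have UU: "conj_transpose U *v (U *v x) = x" for x
    using assms(2) by (simp add: unitary_def matrix_vector_mul_assoc)
  \<comment> \<open>Replace y by U y in \<open>block\<close>: as U^* X = Y, the off-diagonal block
    becomes Y and Q becomes U^* Q U.\<close>
  have "Y \<preceq>\<^sub>L geom_mean (1/2) P (conj_transpose U ** Q ** U)"
  proof (rule geom_mean_maximal[OF P _ Y])
    show "pos_semidef (conj_transpose U ** Q ** U)"
      using pos_semidef_congruence[OF Q, of "conj_transpose U"] by simp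
    show "0 \<le> inner x (P *v x) + 2 * inner x (Y *v y) + inner y ((conj_transpose U ** Q ** U) *v y)"
      for x y
    proof -
      have "inner (U *v y) (X *v x) = inner x (Y *v y)"
        using inner_adjoint[of "U *v y" U "Y *v x"] hermitian_inner[OF Y, of x y]
        by (simp add: X UU inner_commute[of y] flip: matrix_vector_mul_assoc)
      moreover have "inner (U *v y) (Q *v (U *v y)) = inner y ((conj_transpose U ** Q ** U) *v y)"
        by (simp add: inner_adjoint[of y "conj_transpose U"] flip: matrix_vector_mul_assoc)
      ultimately show ?thesis using block[of x "U *v y"] by simp
    qed
  qed
  \<comment> \<open>Replace x by U^* x in \<open>block\<close>: the off-diagonal block becomes X U^*
    = U Y U^*, which is |X^*| by \<open>matrix_abs_conj_transpose\<close>.\<close>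
  moreover have "U ** Y ** conj_transpose U \<preceq>\<^sub>L geom_mean (1/2) (U ** P ** conj_transpose U) Q"
  proof (rule geom_mean_maximal[OF pos_semidef_congruence[OF P] Q hermitian_congruence[OF Y]])
    show "0 \<le> inner x ((U ** P ** conj_transpose U) *v x)
      + 2 * inner x ((U ** Y ** conj_transpose U) *v y) + inner y (Q *v y)" for x y
    proof -
      have "inner y (X *v (conj_transpose U *v x)) = inner x ((U ** Y ** conj_transpose U) *v y)"
        using hermitian_inner[OF hermitian_congruence[OF Y, of U], of x y]
        by (simp add: X inner_commute[of y] matrix_vector_mul_assoc)
      moreover have "inner (conj_transpose U *v x) (P *v (conj_transpose U *v x)) =
          inner x ((U ** P ** conj_transpose U) *v x)"
        by (simp add: inner_adjoint[of x U] flip: matrix_vector_mul_assoc)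
      ultimately show ?thesis using block[of "conj_transpose U *v x" y] by simp
    qed
  qed
  ultimately show ?thesis
    using matrix_abs_conj_transpose[OF assms(2,3)] by (simp add: P_def Q_def Y_def)
qed

end
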